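(* Let $\Phi$ be any (non-empty) set of target functions such that $0\le\alpha(\Phi)<1$. Then $\Phi$ is compatible with respect to the fault-tolerant $(n,f)$-convergence problem to a convex $f$-gon (FC($f$)-CP) for any $2\le f\le n-1$, where $n$ is the number of robots.
   Context: Robot model. Robots $r_1,\dots,r_n$ are points in the plane $\mathbb{R}^2$, which carries a fixed right-handed global coordinate system $Z_0$. Time is discrete, $t=0,1,2,\dots$; $\mathbf{x}_t(r_i)$ is the position of $r_i$ at time $t$ in $Z_0$, and the configuration at $t$ is the multiset $P_t=\{\mathbf{x}_t(r_i):1\le i\le n\}$. Robot $r_i$ has a local coordinate system $Z_i$, right-handed, with its own unit length and axis directions (arbitrary, fixed over time), whose origin is always the current position of $r_i$; $\gamma_i$ denotes the coordinate transformation from $Z_i$ to $Z_0$ (an orientation-preserving similarity with $\gamma_i((0,0))=\mathbf{x}_t(r_i)$ at time $t$). A target function $\phi$ assigns to every multiset $P$ of $n$ points of $\mathbb{R}^2$ (for every $n\ge1$) an element of $\mathbb{R}^2\cup\{\bot\}$, with $\phi(P)=\bot$ if and only if $(0,0)\notin P$. Each robot $r_i$ is assigned a target function $\phi_i$. The scheduler is semi-synchronous: at each time $t$ an arbitrary subset of robots is activated; if a non-crashed $r_i$ is activated at $t$ then $\mathbf{x}_{t+1}(r_i)=\gamma_i(\phi_i(\gamma_i^{-1}(P_t)))$, otherwise $\mathbf{x}_{t+1}(r_i)=\mathbf{x}_t(r_i)$. The schedule is fair: every robot is activated infinitely often. A faulty robot may crash at an arbitrary time, after which it never moves again; crashed robots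 cannot be distinguished from other robots. The sequence $P_0,P_1,\dots$ is an execution. Scale. $CH(P)$ is the convex hull of $P$, $g(P)=\frac1n\sum_{\mathbf{x}\in P}\mathbf{x}$ (with multiplicity), and $d*CH(P)=\{d\mathbf{x}+(1-d)g(P):\mathbf{x}\in CH(P)\}$ for $d\ge0$. $\alpha(\phi,P)$ is the smallest $d\ge 0$ with $\phi(P)\in d*CH(P)$ (and $0$ if $\phi(P)=\bot$; $\infty$ if there is no such $d$). $\alpha(\phi)=\sup_P\alpha(\phi,P)$ and $\alpha(\Phi)=\sup_{\phi\in\Phi}\alpha(\phi)$. Compatibility. $\Phi$ is compatible with respect to FC($f$)-CP if, for every number $n\ge f+1$ of robots, every assignment of target functions from $\Phi$ to the robots (different robots may get different ones), every choice of local coordinate systems, every initial configuration, every fair schedule and every pattern of crashes in which at most $f$ robots are faulty, the convex hull $CH(P_t)$ of the positions of all robots (including faulty ones) converges as $t\to\infty$ to a convex $h$-gon $CH$ for some $h\le f$ (a $1$-gon is a point, a $2$-gon is a line segment), in such a way that for each vertex of $CH$ there is a robot that converges to that vertex. *)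

theory Defs
  imports "HOL-Analysis.Analysis" "HOL-Library.Multiset" "HOL-Library.Extended_Nat"
begin

type_synonym point = "real^2"
type_synonym target = "point multiset \<Rightarrow> point option"

text \<open>The option value \<open>None\<close> plays the role of \<open>\<bottom>\<close>. Configurations have at least one point,
  so the value of a target function at the empty multiset is irrelevant and left unconstrained.\<close>

definition target_function :: "target \<Rightarrow> bool" where
  "target_function \<phi> \<longleftrightarrow> (\<forall>P. P \<noteq> {#} \<longrightarrow> (\<phi> P = None \<longleftrightarrow> 0 \<notin># P))"

definition CH :: "point multiset \<Rightarrow> point set" where
  "CH P = convex hull (set_mset P)"

definition center_of_gravity :: "point multiset \<Rightarrow> point" where
  "center_of_gravity P = (\<Sum>x\<in>#P. x) /\<^sub>R real (size P)"

definition scaled_CH :: "real \<Rightarrow> point multiset \<Rightarrow> point set" where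
  "scaled_CH d P = {d *\<^sub>R x + (1 - d) *\<^sub>R center_of_gravity P | x. x \<in> CH P}"

definition scale_at :: "target \<Rightarrow> point multiset \<Rightarrow> ereal" where
  "scale_at \<phi> P =
     (case \<phi> P of
        None \<Rightarrow> 0
      | Some y \<Rightarrow>
          if \<exists>d\<ge>0. y \<in> scaled_CH d P
          then ereal (LEAST d. d \<ge> 0 \<and> y \<in> scaled_CH d P)
          else \<infinity>)"

definition scale_fun :: "target \<Rightarrow> ereal" where
  "scale_fun \<phi> = (SUP P\<in>{P. P \<noteq> {#}}. scale_at \<phi> P)"

definition scale_set :: "target set \<Rightarrow> ereal" where
  "scale_set \<Phi> = (SUP \<phi>\<in>\<Phi>. scale_fun \<phi>)"

text \<open>The \<open>LEAST\<close> in \<open>scale_at\<close> is meaningful: the minimum exists whenever there is an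
  admissible \<open>d\<close> at all.\<close>

lemma scale_least_exists:
  assumes "\<exists>d\<ge>0. y \<in> scaled_CH d P"
  obtains m where "m \<ge> 0" "y \<in> scaled_CH m P"
    "\<And>d. d \<ge> 0 \<Longrightarrow> y \<in> scaled_CH d P \<Longrightarrow> m \<le> d"
    "(LEAST d. d \<ge> 0 \<and> y \<in> scaled_CH d P) = m"
proof -
  from assms obtain d0 where d0: "d0 \<ge> 0" "y \<in> scaled_CH d0 P" by blast
  let ?g = "center_of_gravity P"
  define K where "K = ({0..d0} \<times> CH P) \<inter> {p. fst p *\<^sub>R snd p + (1 - fst p) *\<^sub>R ?g = y}"
  have "compact (CH P)"
    unfolding CH_def by (intro compact_convex_hull finite_imp_compact) simp
  moreover have "closed {p. fst p *\<^sub>R snd p + (1 - fst p) *\<^sub>R ?g = y}"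
    by (intro closed_Collect_eq continuous_intros)
  ultimately have "compact K"
    unfolding K_def by (intro compact_Int_closed compact_Times) auto
  then have cpt: "compact (fst ` K)"
    by (intro compact_continuous_image continuous_intros)
  have mem: "d \<in> fst ` K \<longleftrightarrow> 0 \<le> d \<and> d \<le> d0 \<and> y \<in> scaled_CH d P" for d
    unfolding K_def scaled_CH_def by (force simp: image_iff)
  have "fst ` K \<noteq> {}" using mem[of d0] d0 by blast
  then obtain m where m: "m \<in> fst ` K" "\<forall>d\<in>fst ` K. m \<le> d"
    using compact_attains_inf[OF cpt] by blast
  have least: "m \<le> d" if "d \<ge> 0" "y \<in> scaled_CH d P" for d
    using m mem that by (meson linear order_trans)
  have "(LEAST d. d \<ge> 0 \<and> y \<in> scaled_CH d P) = m"
    using m(1) mem least by (intro Least_equality) auto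
  with m(1) mem least show ?thesis using that by blast
qed

text \<open>The transformation from a local right-handed coordinate system with unit length \<open>u\<close>, axis
  directions given by the columns of the rotation \<open>A\<close>, and origin \<open>p\<close> to the global system.\<close>

definition local_to_global :: "real \<Rightarrow> real^2^2 \<Rightarrow> point \<Rightarrow> point \<Rightarrow> point" where
  "local_to_global u A p y = p + u *\<^sub>R (A *v y)"

text \<open>Robots are the indices \<open>i < n\<close>, and \<open>x t i\<close> is the position of robot \<open>i\<close> at time \<open>t\<close>.\<close>

definition configuration :: "nat \<Rightarrow> (nat \<Rightarrow> point) \<Rightarrow> point multiset" where
  "configuration n pos = image_mset pos (mset_set {..<n})"

definition fair_schedule :: "nat \<Rightarrow> (nat \<Rightarrow> nat set) \<Rightarrow> bool" where
  "fair_schedule n act \<longleftrightarrow>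
     (\<forall>t. act t \<subseteq> {..<n}) \<and> (\<forall>i<n. \<exists>\<^sub>\<infinity>t. i \<in> act t)"

text \<open>\<open>crash i\<close> is the crash time of robot \<open>i\<close>, and \<open>\<infinity>\<close> if it never crashes; from time \<open>crash i\<close>
  on, activations of \<open>i\<close> have no effect.\<close>

definition execution ::
  "nat \<Rightarrow> (nat \<Rightarrow> target) \<Rightarrow> (nat \<Rightarrow> real) \<Rightarrow> (nat \<Rightarrow> real^2^2) \<Rightarrow> (nat \<Rightarrow> nat set) \<Rightarrow>
   (nat \<Rightarrow> enat) \<Rightarrow> (nat \<Rightarrow> nat \<Rightarrow> point) \<Rightarrow> bool" where
  "execution n phi u A act crash x \<longleftrightarrow>
     (\<forall>t. \<forall>i<n.
        let \<gamma> = local_to_global (u i) (A i) (x t i) in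
        if i \<in> act t \<and> enat t < crash i
        then Some (x (Suc t) i) =
               map_option \<gamma> (phi i (image_mset (inv \<gamma>) (configuration n (x t))))
        else x (Suc t) i = x t i)"

definition convex_ngon :: "nat \<Rightarrow> point set \<Rightarrow> bool" where
  "convex_ngon h C \<longleftrightarrow> h \<ge> 1 \<and> polytope C \<and> card {v. v extreme_point_of C} = h"

text \<open>Convergence of sets with respect to the Hausdorff distance.\<close>

definition set_converges_to :: "(nat \<Rightarrow> point set) \<Rightarrow> point set \<Rightarrow> bool" where
  "set_converges_to S C \<longleftrightarrow>
     (\<forall>e>0. \<forall>\<^sub>F t in sequentially.
        (\<forall>x\<in>S t. \<exists>y\<in>C. dist x y < e) \<and> (\<forall>y\<in>C. \<exists>x\<in>S t. dist x y < e))"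

definition compatible_FC_CP :: "target set \<Rightarrow> nat \<Rightarrow> bool" where
  "compatible_FC_CP \<Phi> f \<longleftrightarrow>
     (\<forall>n\<ge>f + 1. \<forall>phi u A act crash x.
        (\<forall>i<n. phi i \<in> \<Phi>) \<and>
        (\<forall>i<n. u i > 0 \<and> rotation_matrix (A i)) \<and>
        fair_schedule n act \<and>
        card {i. i < n \<and> crash i \<noteq> \<infinity>} \<le> f \<and>
        execution n phi u A act crash x \<longrightarrow>
        (\<exists>h C. h \<le> f \<and> convex_ngon h C \<and>
           set_converges_to (\<lambda>t. CH (configuration n (x t))) C \<and>
           (\<forall>v. v extreme_point_of C \<longrightarrow> (\<exists>i<n. (\<lambda>t. x t i) \<longlonglongrightarrow> v))))"

end

theory Submission
  imports Defs
begin

text \<open>An active robot moves to a point \<open>d y + (1 - d) g\<close> with \<open>y\<close> and the centre of gravity \<open>g\<close> in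
  the current hull and \<open>d \<le> \<alpha> < 1\<close>. Hence the hulls decrease, and by compactness their limit \<open>C\<close> is
  their intersection, a polytope each of whose extreme points \<open>v\<close> is eventually approximated by some
  robot. If \<open>C\<close> is not a single point, take a linear functional exposing \<open>v\<close>. Some robot stays near
  another vertex, which keeps \<open>g\<close> below the level of \<open>v\<close> by a definite amount, and hence so does
  every target point. Thus a robot that is active late enough remains away from \<open>v\<close> for ever, so
  only crashed robots can be near \<open>v\<close>; being immobile, one of them sits at \<open>v\<close>. So \<open>C\<close> has at most
  as many vertices as there are faulty robots.\<close>

section \<open>Decreasing hulls of finitely many points\<close>

text \<open>Bolzano-Weierstrass, one index at a time: the subsequence extracted for a new index
  keeps the limits found before. This gives all robots limit positions along common times.\<close>

lemma convergent_subseq_finite_family: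
  fixes x :: "nat \<Rightarrow> 'i \<Rightarrow> 'a::heine_borel"
  assumes "finite I" and "\<And>i. i \<in> I \<Longrightarrow> bounded (range (\<lambda>t. x t i))"
  shows "\<exists>r p. strict_mono r \<and> (\<forall>i\<in>I. (\<lambda>k. x (r k) i) \<longlonglongrightarrow> p i)"
  using assms
proof (induction I rule: finite_induct)
  case empty
  show ?case using strict_mono_id by auto
next
  case (insert j I)
  then obtain r p where r: "strict_mono r" "\<forall>i\<in>I. (\<lambda>k. x (r k) i) \<longlonglongrightarrow> p i"
    by auto
  have "bounded (range (\<lambda>k. x (r k) j))"
    using insert.prems[of j] by (auto intro: bounded_subset)
  then obtain l s where s: "strict_mono s" "((\<lambda>k. x (r k) j) \<circ> s) \<longlonglongrightarrow> l"
    using bounded_imp_convergent_subsequence by blast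
  have "(\<lambda>k. x ((r \<circ> s) k) i) \<longlonglongrightarrow> (p(j := l)) i" if "i \<in> insert j I" for i
  proof (cases "i = j")
    case True
    then show ?thesis using s by (simp add: o_def)
  next
    case False
    then show ?thesis
      using that r(2) LIMSEQ_subseq_LIMSEQ[OF _ s(1), of "\<lambda>k. x (r k) i" "p i"]
      by (auto simp: o_def)
  qed
  moreover have "strict_mono (r \<circ> s)" using r(1) s(1) by (rule strict_mono_o)
  ultimately show ?case by blast
qed

text \<open>The Minkowski sum of the second hull and the open \<open>e\<close>-ball is convex and
  contains every \<open>p i\<close>, hence contains the first hull.\<close>

lemma convex_hull_image_perturb:
  fixes p q :: "'i \<Rightarrow> 'a::real_normed_vector"
  assumes "\<And>i. i \<in> I \<Longrightarrow> dist (p i) (q i) < e" and "z \<in> convex hull (p ` I)"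
  shows "\<exists>y\<in>convex hull (q ` I). dist z y < e"
proof -
  let ?S = "\<Union>y\<in>convex hull (q ` I). \<Union>b\<in>ball 0 e. {y + b}"
  have "convex ?S" by (intro convex_sums convex_convex_hull convex_ball)
  moreover have "p ` I \<subseteq> ?S"
  proof
    fix a assume "a \<in> p ` I"
    then obtain i where i: "i \<in> I" "a = p i" by blast
    have "p i - q i \<in> ball 0 e" using assms(1)[OF i(1)] by (simp add: dist_norm norm_minus_commute)
    moreover have "q i \<in> convex hull (q ` I)" using i by (simp add: hull_inc)
    ultimately show "a \<in> ?S" unfolding i(2) by (intro UN_I[of "q i"] UN_I[of "p i - q i"]) auto
  qed
  ultimately have "convex hull (p ` I) \<subseteq> ?S" by (rule hull_minimal[rotated])
  then obtain y b where "y \<in> convex hull (q ` I)" "b \<in> ball 0 e" "z = y + b"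
    using assms(2) by blast
  then show ?thesis by (intro bexI[of _ y]) (auto simp: dist_norm)
qed

text \<open>Only monotonicity of the hulls is assumed, so the results here are independent of
  schedules, crashes and target functions.\<close>

locale shrinking_hulls =
  fixes n :: nat and x :: "nat \<Rightarrow> nat \<Rightarrow> 'a::euclidean_space"
  assumes n_pos: "0 < n"
    and hull_Suc: "\<And>t. convex hull (x (Suc t) ` {..<n}) \<subseteq> convex hull (x t ` {..<n})"
begin

definition hull_at :: "nat \<Rightarrow> 'a set" where
  "hull_at t = convex hull (x t ` {..<n})"

definition limit_hull :: "'a set" where
  "limit_hull = (\<Inter>t. hull_at t)"

lemma hull_at_antimono: "s \<le> t \<Longrightarrow> hull_at t \<subseteq> hull_at s"
  by (rule lift_Suc_antimono_le[of hull_at]) (simp_all add: hull_at_def hull_Suc)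

lemma compact_hull_at: "compact (hull_at t)"
  unfolding hull_at_def by (intro compact_convex_hull finite_imp_compact) simp

lemma position_in_hull_at: "i < n \<Longrightarrow> x t i \<in> hull_at t"
  unfolding hull_at_def by (intro hull_inc) simp

lemma bounded_positions:
  assumes "i < n"
  shows "bounded (range (\<lambda>t. x t i))"
proof (rule bounded_subset)
  show "bounded (hull_at 0)" using compact_hull_at by (rule compact_imp_bounded)
  show "range (\<lambda>t. x t i) \<subseteq> hull_at 0"
    using position_in_hull_at[OF assms] hull_at_antimono[of 0] by blast
qed

text \<open>Each \<open>p i\<close> lies in all hulls because these are closed and decreasing.
  Conversely, a point of the intersection lies in the hull at every time \<open>r k\<close>, which
  is eventually close to the hull of the \<open>p i\<close>. The subsequence is arbitrary, so it may
  later be chosen among unfavourable times.\<close>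

lemma limit_hull_subseq:
  assumes r: "strict_mono (r :: nat \<Rightarrow> nat)"
    and lim: "\<And>i. i < n \<Longrightarrow> (\<lambda>k. x (r k) i) \<longlonglongrightarrow> p i"
  shows "limit_hull = convex hull (p ` {..<n})"
proof
  have "p i \<in> hull_at t" if "i < n" for i t
  proof (rule Lim_in_closed_set[OF _ _ _ lim[OF that]])
    show "closed (hull_at t)" using compact_hull_at by (rule compact_imp_closed)
    show "\<forall>\<^sub>F k in sequentially. x (r k) i \<in> hull_at t"
      using eventually_ge_at_top[of t]
    proof eventually_elim
      case (elim k)
      then have "t \<le> r k" using seq_suble[OF r, of k] by linarith
      then show ?case using position_in_hull_at[OF that] hull_at_antimono by blast
    qed
  qed simp
  moreover have "convex limit_hull"
    unfolding limit_hull_def hull_at_def by (intro convex_INT) simp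
  ultimately show "convex hull (p ` {..<n}) \<subseteq> limit_hull"
    unfolding limit_hull_def by (intro hull_minimal) auto
next
  show "limit_hull \<subseteq> convex hull (p ` {..<n})"
  proof
    fix z assume z: "z \<in> limit_hull"
    have "\<exists>y\<in>convex hull (p ` {..<n}). dist y z < e" if "e > 0" for e
    proof -
      have "\<forall>\<^sub>F k in sequentially. \<forall>i\<in>{..<n}. dist (x (r k) i) (p i) < e"
        using lim that by (intro eventually_ball_finite ballI tendstoD) auto
      then obtain k where "\<forall>i\<in>{..<n}. dist (x (r k) i) (p i) < e"
        by (auto dest: eventually_happens)
      moreover have "z \<in> convex hull (x (r k) ` {..<n})"
        using z unfolding limit_hull_def hull_at_def by blast
      ultimately show ?thesis
        using convex_hull_image_perturb[of "{..<n}" "x (r k)" p e z]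
        by (auto simp: dist_commute)
    qed
    then have "z \<in> closure (convex hull (p ` {..<n}))"
      by (simp add: closure_approachable)
    moreover have "closed (convex hull (p ` {..<n}))"
      by (intro compact_imp_closed compact_convex_hull finite_imp_compact) simp
    ultimately show "z \<in> convex hull (p ` {..<n})" by simp
  qed
qed

text \<open>A decreasing intersection of polytopes may have infinitely many extreme points; here the
  fixed number \<open>n\<close> of generators survives in the limit.\<close>

lemma polytope_limit_hull: "polytope limit_hull"
proof -
  obtain r p where "strict_mono (r :: nat \<Rightarrow> nat)" "\<forall>i\<in>{..<n}. (\<lambda>k. x (r k) i) \<longlonglongrightarrow> p i"
    using convergent_subseq_finite_family[of "{..<n}" x] bounded_positions by auto
  then have "limit_hull = convex hull (p ` {..<n})" by (intro limit_hull_subseq) auto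
  then show ?thesis unfolding polytope_def by (intro exI[of _ "p ` {..<n}"]) simp
qed

lemma limit_hull_nonempty: "limit_hull \<noteq> {}"
proof -
  obtain r p where "strict_mono (r :: nat \<Rightarrow> nat)" "\<forall>i\<in>{..<n}. (\<lambda>k. x (r k) i) \<longlonglongrightarrow> p i"
    using convergent_subseq_finite_family[of "{..<n}" x] bounded_positions by auto
  then have "limit_hull = convex hull (p ` {..<n})" by (intro limit_hull_subseq) auto
  then show ?thesis using n_pos by auto
qed

text \<open>If all robots were far from \<open>v\<close> infinitely often, limit positions along
  such times would still span \<open>limit_hull\<close>, so \<open>v\<close> would be one of them.
  The robot near \<open>v\<close> may change with \<open>t\<close>.\<close>

lemma robot_near_extreme_point:
  assumes v: "v extreme_point_of limit_hull" and e: "e > 0"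
  shows "\<forall>\<^sub>F t in sequentially. \<exists>i<n. dist (x t i) v < e"
proof (rule ccontr)
  assume "\<not> ?thesis"
  then have "\<exists>\<^sub>\<infinity>t. \<not> (\<exists>i<n. dist (x t i) v < e)"
    by (simp only: not_eventually cofinite_eq_sequentially simp_thms)
  then have "\<exists>\<^sub>\<infinity>t. \<forall>i<n. e \<le> dist (x t i) v"
    by (rule INFM_mono) (meson not_less)
  then have inf: "infinite {t. \<forall>i<n. e \<le> dist (x t i) v}"
    unfolding frequently_cofinite by simp
  define s where "s = enumerate {t. \<forall>i<n. e \<le> dist (x t i) v}"
  have s: "strict_mono s" "\<And>k i. i < n \<Longrightarrow> e \<le> dist (x (s k) i) v"
    using strict_mono_enumerate[OF inf] enumerate_in_set[OF inf] unfolding s_def by auto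
  have "bounded (range (\<lambda>k. x (s k) i))" if "i < n" for i
    using bounded_positions[OF that] by (auto intro: bounded_subset)
  then obtain r p where r: "strict_mono (r :: nat \<Rightarrow> nat)"
      and lim: "\<forall>i\<in>{..<n}. (\<lambda>k. x (s (r k)) i) \<longlonglongrightarrow> p i"
    using convergent_subseq_finite_family[of "{..<n}" "\<lambda>k. x (s k)"] by auto
  have "limit_hull = convex hull (p ` {..<n})"
    using limit_hull_subseq[OF strict_mono_o[OF s(1) r]] lim by (simp add: o_def)
  \<comment> \<open>An extreme point of the hull of a set belongs to that set.\<close>
  then have "v \<in> p ` {..<n}" using v extreme_point_of_convex_hull by metis
  then obtain i where i: "i < n" "v = p i" by auto
  have "(\<lambda>k. dist (x (s (r k)) i) v) \<longlonglongrightarrow> dist (p i) v"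
    using lim i by (intro tendsto_intros) auto
  then have "e \<le> dist (p i) v"
    using s(2)[OF i(1)] by (intro LIMSEQ_le_const) auto
  then show False using i e by simp
qed

text \<open>The sets \<open>hull_at t - U\<close> are nested and compact; if none were empty, they
  would share a point of \<open>limit_hull\<close> outside \<open>U\<close>.\<close>

lemma eventually_hull_at_subset:
  assumes "open U" "limit_hull \<subseteq> U"
  shows "\<forall>\<^sub>F t in sequentially. hull_at t \<subseteq> U"
proof -
  have "\<exists>T. hull_at T \<subseteq> U"
  proof (rule ccontr)
    assume "\<nexists>T. hull_at T \<subseteq> U"
    then have ne: "\<And>t. hull_at t - U \<noteq> {}" by blast
    have "\<And>t. compact (hull_at t - U)"
      using compact_hull_at assms(1) by (rule compact_diff)
    moreover note ne
    moreover have "\<And>s t. s \<le> t \<Longrightarrow> hull_at t - U \<subseteq> hull_at s - U"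
      using hull_at_antimono by blast
    ultimately have "(\<Inter>t. hull_at t - U) \<noteq> {}" by (rule compact_nest)
    then show False using assms(2) unfolding limit_hull_def by blast
  qed
  then show ?thesis
    unfolding eventually_sequentially using hull_at_antimono by blast
qed

text \<open>This is the half of Hausdorff convergence that uses compactness; the other half is the
  inclusion of \<open>limit_hull\<close> in every hull.\<close>

lemma eventually_hull_at_near:
  assumes "e > 0"
  shows "\<forall>\<^sub>F t in sequentially. \<forall>z\<in>hull_at t. \<exists>y\<in>limit_hull. dist z y < e"
proof -
  let ?U = "\<Union>y\<in>limit_hull. ball y e"
  have "\<forall>\<^sub>F t in sequentially. hull_at t \<subseteq> ?U"
    using assms by (intro eventually_hull_at_subset) auto
  then show ?thesis
    by eventually_elim (force simp: dist_commute)
qed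

lemma limit_hull_eq_hull_extreme_points:
  "limit_hull = convex hull {v. v extreme_point_of limit_hull}"
  using polytope_limit_hull
  by (intro Krein_Milman_Minkowski) (auto simp: polytope_imp_compact polytope_imp_convex)

lemma finite_extreme_points: "finite {v. v extreme_point_of limit_hull}"
  using polytope_limit_hull by (intro finite_polyhedron_extreme_points polytope_imp_polyhedron)

end

text \<open>A convex set stays convex when an extreme point is removed, so the compact hull of
  \<open>E\<close> misses \<open>v\<close> and can be strictly separated from it.\<close>

lemma extreme_point_separation:
  fixes v :: "'a::euclidean_space"
  assumes "convex S" "v extreme_point_of S" "finite E" "E \<subseteq> S" "v \<notin> E"
  shows "\<exists>a b. b < a \<bullet> v \<and> (\<forall>w\<in>E. a \<bullet> w < b)"
proof -
  have "convex (S - {v})" using assms(1,2) extreme_point_of_stillconvex by blast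
  then have "convex hull E \<subseteq> S - {v}" using assms(4,5) by (intro hull_minimal) auto
  then have "v \<notin> convex hull E" by blast
  moreover have "closed (convex hull E)"
    using assms(3) by (intro compact_imp_closed compact_convex_hull finite_imp_compact)
  ultimately obtain a b where "a \<bullet> v < b" "\<forall>w\<in>convex hull E. b < a \<bullet> w"
    using separating_hyperplane_closed_point[of "convex hull E" v] convex_convex_hull by blast
  then show ?thesis
    by (intro exI[of _ "- a"] exI[of _ "- b"]) (auto simp: hull_inc)
qed

section \<open>Contracting moves\<close>

text \<open>Summing over indices counts coinciding robots with multiplicity, as the centre of
  gravity of a multiset does.\<close>

definition centroid :: "nat \<Rightarrow> (nat \<Rightarrow> 'a::real_vector) \<Rightarrow> 'a" where
  "centroid n p = (\<Sum>i<n. p i) /\<^sub>R real n"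

lemma centroid_in_convex_hull:
  assumes "0 < n"
  shows "centroid n p \<in> convex hull (p ` {..<n})"
proof -
  have "(\<Sum>i<n. inverse (real n) *\<^sub>R p i) \<in> convex hull (p ` {..<n})"
    using assms by (intro convex_sum) (auto simp: hull_inc)
  then show ?thesis by (simp add: centroid_def scaleR_sum_right)
qed

text \<open>Every point has weight \<open>1 / n\<close> in the average, so a deficit
  \<open>c\<close> of a single point lowers the bound by \<open>c / n\<close>.\<close>

lemma inner_centroid_le:
  fixes p :: "nat \<Rightarrow> 'a::real_inner"
  assumes "\<And>i. i < n \<Longrightarrow> a \<bullet> p i \<le> M" and "j < n" "a \<bullet> p j \<le> M - c"
  shows "a \<bullet> centroid n p \<le> M - c / real n"
proof -
  have "(\<Sum>i<n. a \<bullet> p i) = a \<bullet> p j + (\<Sum>i\<in>{..<n} - {j}. a \<bullet> p i)"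
    using assms(2) by (intro sum.remove) auto
  also have "(\<Sum>i\<in>{..<n} - {j}. a \<bullet> p i) \<le> (\<Sum>i\<in>{..<n} - {j}. M)"
    using assms(1) by (intro sum_mono) auto
  also have "\<dots> = (real n - 1) * M"
    using assms(2) by (simp add: of_nat_diff)
  finally have "(\<Sum>i<n. a \<bullet> p i) \<le> real n * M - c"
    using assms(3) by (simp add: algebra_simps)
  then show ?thesis
    using assms(2) by (simp add: centroid_def inner_sum_right divide_simps algebra_simps)
qed

text \<open>\<open>moves t i\<close> merges activation and absence of a crash into one predicate.
  The factor \<open>d\<close> may vary with time and robot, but \<alpha> bounds it
  uniformly.\<close>

locale contracting_moves =
  fixes n :: nat and x :: "nat \<Rightarrow> nat \<Rightarrow> 'a::euclidean_space"
    and moves :: "nat \<Rightarrow> nat \<Rightarrow> bool" and \<alpha> :: real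
  assumes n_pos: "0 < n" and \<alpha>_less: "\<alpha> < 1"
    and idle: "\<And>t i. i < n \<Longrightarrow> \<not> moves t i \<Longrightarrow> x (Suc t) i = x t i"
    and move: "\<And>t i. i < n \<Longrightarrow> moves t i \<Longrightarrow>
      \<exists>d y. 0 \<le> d \<and> d \<le> \<alpha> \<and> y \<in> convex hull (x t ` {..<n}) \<and>
        x (Suc t) i = d *\<^sub>R y + (1 - d) *\<^sub>R centroid n (x t)"

sublocale contracting_moves \<subseteq> shrinking_hulls n x
proof
  show "0 < n" by (rule n_pos)
  fix t
  let ?H = "convex hull (x t ` {..<n})"
  have "x (Suc t) i \<in> ?H" if i: "i < n" for i
  proof (cases "moves t i")
    case True
    then obtain d y where "0 \<le> d" "d \<le> \<alpha>" "y \<in> ?H"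
        "x (Suc t) i = d *\<^sub>R y + (1 - d) *\<^sub>R centroid n (x t)"
      using move[OF i] by blast
    then show ?thesis
      using \<alpha>_less centroid_in_convex_hull[OF n_pos, of "x t"]
      by (auto intro!: convexD[OF convex_convex_hull])
  next
    case False
    then show ?thesis using idle[OF i] i by (simp add: hull_inc)
  qed
  then show "convex hull (x (Suc t) ` {..<n}) \<subseteq> ?H"
    by (intro hull_minimal) auto
qed

context contracting_moves
begin

text \<open>A second vertex \<open>w\<close> always has a robot nearby at late times, which pulls
  the centroid below the level of \<open>v\<close>. Since \<open>1 - d\<close> is at least
  \<open>1 - \<alpha>\<close>, each move inherits a fixed part of this deficit.\<close>

lemma move_avoids_extreme_point:
  assumes v: "v extreme_point_of limit_hull" and ne: "limit_hull \<noteq> {v}"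
  shows "\<exists>a e. 0 < e \<and>
    (\<forall>\<^sub>F t in sequentially. \<forall>i<n. moves t i \<longrightarrow> a \<bullet> x (Suc t) i \<le> a \<bullet> v - e)"
proof -
  let ?E = "{w. w extreme_point_of limit_hull}"
  have "?E \<noteq> {v}"
    using ne limit_hull_eq_hull_extreme_points by (metis convex_hull_singleton)
  then obtain w where w: "w extreme_point_of limit_hull" "w \<noteq> v" using v by blast
  have conv: "convex limit_hull" using polytope_limit_hull by (rule polytope_imp_convex)
  obtain a b where ab: "b < a \<bullet> v" "\<forall>w\<in>?E - {v}. a \<bullet> w < b"
    using extreme_point_separation[OF conv v, of "?E - {v}"] finite_extreme_points
    by (auto simp: extreme_point_of_def)
  define c where "c = a \<bullet> v - b"
  \<comment> \<open>The guaranteed drop \<open>(1 - \<alpha>) * c / n\<close> is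
    \<open>2 * e\<close>: one \<open>e\<close> pays for late hulls overshooting the level of
    \<open>v\<close>, the other remains as margin.\<close>
  define e where "e = (1 - \<alpha>) * c / (2 * real n)"
  have c: "0 < c" using ab by (simp add: c_def)
  have e: "0 < e" using c \<alpha>_less n_pos by (simp add: e_def)
  have "convex hull ?E \<subseteq> {z. a \<bullet> z \<le> a \<bullet> v}"
    using ab by (intro hull_minimal convex_halfspace_le) force
  then have "limit_hull \<subseteq> {z. a \<bullet> z < a \<bullet> v + e}"
    using limit_hull_eq_hull_extreme_points e by force
  then have ev1: "\<forall>\<^sub>F t in sequentially. hull_at t \<subseteq> {z. a \<bullet> z < a \<bullet> v + e}"
    by (intro eventually_hull_at_subset open_halfspace_lt)
  have "open {z. a \<bullet> z < b}" by (rule open_halfspace_lt)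
  moreover have "w \<in> {z. a \<bullet> z < b}" using ab w by blast
  ultimately obtain \<delta> where \<delta>: "\<delta> > 0" "ball w \<delta> \<subseteq> {z. a \<bullet> z < b}"
    using open_contains_ball by blast
  from robot_near_extreme_point[OF w(1) \<delta>(1)]
  have "\<forall>\<^sub>F t in sequentially. \<exists>j<n. a \<bullet> x t j < b"
    by eventually_elim (use \<delta>(2) in \<open>force simp: dist_commute subset_iff\<close>)
  with ev1 have "\<forall>\<^sub>F t in sequentially. \<forall>i<n. moves t i \<longrightarrow> a \<bullet> x (Suc t) i \<le> a \<bullet> v - e"
  proof eventually_elim
    case (elim t)
    let ?M = "a \<bullet> v + e"
    have M: "a \<bullet> z \<le> ?M" if "z \<in> hull_at t" for z using elim(1) that by force
    obtain j where j: "j < n" "a \<bullet> x t j < b" using elim(2) by blast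
    \<comment> \<open>Here \<open>?M - c = b + e\<close>, and robot \<open>j\<close> is even below
      \<open>b\<close>.\<close>
    have g: "a \<bullet> centroid n (x t) \<le> ?M - c / real n"
      using M position_in_hull_at j e by (intro inner_centroid_le[of n _ _ _ j]) (auto simp: c_def)
    show ?case
    proof (intro allI impI)
      fix i assume "i < n" "moves t i"
      then obtain d y where dy: "0 \<le> d" "d \<le> \<alpha>" "y \<in> hull_at t"
          "x (Suc t) i = d *\<^sub>R y + (1 - d) *\<^sub>R centroid n (x t)"
        using move unfolding hull_at_def by blast
      have "a \<bullet> x (Suc t) i = d * (a \<bullet> y) + (1 - d) * (a \<bullet> centroid n (x t))"
        by (simp add: dy(4) inner_simps)
      also have "\<dots> \<le> d * ?M + (1 - d) * (?M - c / real n)"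
        using dy \<alpha>_less M g by (intro add_mono mult_left_mono) auto
      also have "\<dots> = ?M - (1 - d) * (c / real n)" by (simp add: algebra_simps)
      also have "\<dots> \<le> ?M - (1 - \<alpha>) * (c / real n)"
        using dy(2) c by (intro diff_left_mono mult_right_mono) auto
      also have "\<dots> = a \<bullet> v - e" by (simp add: e_def field_simps)
      finally show "a \<bullet> x (Suc t) i \<le> a \<bullet> v - e" .
    qed
  qed
  with e show ?thesis by blast
qed

text \<open>Robots outside \<open>F\<close> end up at a fixed distance from \<open>v\<close>, and
  those in \<open>F\<close> rest at \<open>q i\<close>. If no \<open>q i\<close> were
  \<open>v\<close>, a whole ball around \<open>v\<close> would eventually contain no robot.\<close>

lemma extreme_point_occupied:
  assumes v: "v extreme_point_of limit_hull" and ne: "limit_hull \<noteq> {v}"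
    and F: "F \<subseteq> {..<n}"
    and live: "\<And>i. i < n \<Longrightarrow> i \<notin> F \<Longrightarrow> \<exists>\<^sub>\<infinity>t. moves t i"
    and stop: "\<And>i. i \<in> F \<Longrightarrow> \<forall>\<^sub>F t in sequentially. x t i = q i"
  shows "\<exists>i\<in>F. q i = v"
proof (rule ccontr)
  assume "\<not> ?thesis"
  then have qv: "\<And>i. i \<in> F \<Longrightarrow> 0 < dist (q i) v" by simp
  have finF: "finite F" using F finite_subset by blast
  obtain a e where e: "0 < e" and
    away: "\<forall>\<^sub>F t in sequentially. \<forall>i<n. moves t i \<longrightarrow> a \<bullet> x (Suc t) i \<le> a \<bullet> v - e"
    using move_avoids_extreme_point[OF v ne] by blast
  from away obtain T where T: "\<And>t i. T \<le> t \<Longrightarrow> i < n \<Longrightarrow> moves t i \<Longrightarrow> a \<bullet> x (Suc t) i \<le> a \<bullet> v - e"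
    unfolding eventually_sequentially by blast
  have "\<forall>\<^sub>F t in sequentially. a \<bullet> x t i \<le> a \<bullet> v - e" if i: "i < n" "i \<notin> F" for i
  proof -
    obtain s where s: "s \<ge> T" "moves s i"
      using live[OF i] unfolding INFM_nat_le by blast
    \<comment> \<open>After one late move the bound persists: an idle step keeps the position, and
      any further move satisfies the same bound.\<close>
    have "a \<bullet> x t i \<le> a \<bullet> v - e" if "Suc s \<le> t" for t
      using that
    proof (induction t rule: dec_induct)
      case base
      then show ?case using T s i by blast
    next
      case (step t)
      then show ?case using T[of t i] idle[OF i(1), of t] s i by (cases "moves t i") auto
    qed
    then show ?thesis unfolding eventually_sequentially by blast
  qed
  then have "\<forall>\<^sub>F t in sequentially. \<forall>i\<in>{..<n} - F. a \<bullet> x t i \<le> a \<bullet> v - e"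
    by (intro eventually_ball_finite) auto
  moreover have "\<forall>\<^sub>F t in sequentially. \<forall>i\<in>F. x t i = q i"
    using finF stop by (intro eventually_ball_finite) auto
  moreover
  have "open {z. a \<bullet> z > a \<bullet> v - e}" "v \<in> {z. a \<bullet> z > a \<bullet> v - e}"
    using e by (auto simp: open_halfspace_gt)
  then obtain \<delta> where \<delta>: "\<delta> > 0" "ball v \<delta> \<subseteq> {z. a \<bullet> z > a \<bullet> v - e}"
    using open_contains_ball by blast
  \<comment> \<open>This radius excludes all rest positions and stays within the half-space;
    inserting \<delta> keeps \<open>Min\<close> meaningful for empty \<open>F\<close>.\<close>
  define \<epsilon> where "\<epsilon> = Min (insert \<delta> ((\<lambda>i. dist (q i) v) ` F))"
  have \<epsilon>: "0 < \<epsilon>" "\<epsilon> \<le> \<delta>" "\<And>i. i \<in> F \<Longrightarrow> \<epsilon> \<le> dist (q i) v"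
    using finF qv \<delta> by (auto simp: \<epsilon>_def)
  have "\<forall>\<^sub>F t in sequentially. \<exists>i<n. dist (x t i) v < \<epsilon>"
    using robot_near_extreme_point[OF v \<epsilon>(1)] .
  ultimately have "\<forall>\<^sub>F t in sequentially. False"
  proof eventually_elim
    case (elim t)
    then obtain i where i: "i < n" "dist (x t i) v < \<epsilon>" by blast
    show ?case
    proof (cases "i \<in> F")
      case True
      then show ?thesis using elim i \<epsilon>(3)[of i] by auto
    next
      case False
      moreover have "x t i \<in> ball v \<delta>" using i \<epsilon>(2) by (simp add: dist_commute)
      ultimately have "a \<bullet> v - e < a \<bullet> x t i" "a \<bullet> x t i \<le> a \<bullet> v - e"
        using \<delta>(2) elim i(1) by auto
      then show ?thesis by simp
    qed
  qed
  then show False by simp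
qed

end

section \<open>Executions\<close>

lemma CH_configuration: "CH (configuration n p) = convex hull (p ` {..<n})"
  by (simp add: CH_def configuration_def)

lemma center_of_gravity_configuration: "center_of_gravity (configuration n p) = centroid n p"
  by (simp add: center_of_gravity_def configuration_def centroid_def sum_unfold_sum_mset
      image_mset.compositionality o_def)

text \<open>Surjectivity makes \<open>inv\<close> a right inverse, so mapping a local observation
  back returns the global configuration.\<close>

lemma surj_local_to_global:
  assumes "u > 0" "rotation_matrix A"
  shows "surj (local_to_global u A p)"
proof (rule surjI)
  fix y
  have "A ** transpose A = mat 1"
    using assms(2) by (simp add: rotation_matrix_def orthogonal_matrix_def)
  then have "A *v (transpose A *v z) = z" for z
    by (metis matrix_vector_mul_assoc matrix_vector_mul_lid)
  then show "local_to_global u A p (transpose A *v ((y - p) /\<^sub>R u)) = y"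
    using assms(1) by (simp add: local_to_global_def)
qed

text \<open>Affine maps commute with convex hulls, averages and affine combinations, so the factor
  \<open>d\<close> is the same in local and global coordinates. Non-emptiness makes the weights of
  the average sum to 1, which lets the translation pass through.\<close>

lemma scaled_CH_local_to_global:
  assumes "y \<in> scaled_CH d Q" and "Q \<noteq> {#}"
  shows "local_to_global u A p y \<in> scaled_CH d (image_mset (local_to_global u A p) Q)"
proof -
  let ?\<gamma> = "local_to_global u A p" and ?L = "\<lambda>z. u *\<^sub>R (A *v z)"
  have lin: "linear ?L"
    by (intro linear_compose_scale_right matrix_vector_mul_linear)
  have \<gamma>: "?\<gamma> = (\<lambda>z. p + z) \<circ> ?L" by (auto simp: local_to_global_def)
  have "?\<gamma> ` CH Q = CH (image_mset ?\<gamma> Q)"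
    unfolding CH_def \<gamma> set_image_mset image_comp[symmetric]
      convex_hull_linear_image[OF lin, symmetric] convex_hull_translation ..
  moreover have "(\<Sum>z\<in>#Q. ?\<gamma> z) = real (size Q) *\<^sub>R p + ?L (\<Sum>z\<in>#Q. z)"
    by (induction Q)
      (simp_all add: local_to_global_def algebra_simps matrix_vector_right_distrib)
  then have "center_of_gravity (image_mset ?\<gamma> Q) = ?\<gamma> (center_of_gravity Q)"
    using assms(2)
    by (simp add: center_of_gravity_def scaleR_right_distrib)
      (simp add: local_to_global_def matrix_vector_mult_scaleR)
  moreover obtain z where z: "z \<in> CH Q" "y = d *\<^sub>R z + (1 - d) *\<^sub>R center_of_gravity Q"
    using assms(1) by (auto simp: scaled_CH_def)
  moreover have "?\<gamma> (d *\<^sub>R z + (1 - d) *\<^sub>R w) = d *\<^sub>R ?\<gamma> z + (1 - d) *\<^sub>R ?\<gamma> w" for w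
    by (simp add: local_to_global_def algebra_simps matrix_vector_right_distrib
        matrix_vector_mult_scaleR)
  ultimately show ?thesis
    unfolding scaled_CH_def by (auto intro!: exI[of _ "?\<gamma> z"])
qed

text \<open>A real bound rules out the value \<infinity>, and the least factor is attained, so it
  serves as \<open>d\<close>.\<close>

lemma target_in_scaled_CH:
  assumes "\<phi> P = Some y" "P \<noteq> {#}" "scale_fun \<phi> \<le> ereal \<alpha>"
  shows "\<exists>d\<ge>0. d \<le> \<alpha> \<and> y \<in> scaled_CH d P"
proof -
  have le: "scale_at \<phi> P \<le> ereal \<alpha>"
    using assms(2,3) unfolding scale_fun_def by (simp add: SUP_le_iff)
  have ex: "\<exists>d\<ge>0. y \<in> scaled_CH d P"
    using le assms(1) by (auto simp: scale_at_def split: if_splits)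
  then obtain m where "m \<ge> 0" "y \<in> scaled_CH m P" "(LEAST d. d \<ge> 0 \<and> y \<in> scaled_CH d P) = m"
    by (rule scale_least_exists)
  moreover have "scale_at \<phi> P = ereal (LEAST d. d \<ge> 0 \<and> y \<in> scaled_CH d P)"
    using ex assms(1) by (simp add: scale_at_def)
  ultimately show ?thesis using le by auto
qed

lemma execution_contracting_moves:
  assumes "execution n phi u A act crash x" "0 < n" "\<alpha> < 1"
    and scale: "\<And>i. i < n \<Longrightarrow> scale_fun (phi i) \<le> ereal \<alpha>"
    and coord: "\<And>i. i < n \<Longrightarrow> u i > 0 \<and> rotation_matrix (A i)"
  shows "contracting_moves n x (\<lambda>t i. i \<in> act t \<and> enat t < crash i) \<alpha>"
proof
  show "0 < n" "\<alpha> < 1" by fact+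
  fix t i assume i: "i < n"
  let ?\<gamma> = "local_to_global (u i) (A i) (x t i)"
  let ?P = "configuration n (x t)"
  have step: "if i \<in> act t \<and> enat t < crash i
      then Some (x (Suc t) i) = map_option ?\<gamma> (phi i (image_mset (inv ?\<gamma>) ?P))
      else x (Suc t) i = x t i"
    using assms(1) i unfolding execution_def Let_def by blast
  show "x (Suc t) i = x t i" if "\<not> (i \<in> act t \<and> enat t < crash i)"
    using step that by (simp split: if_splits)
  assume "i \<in> act t \<and> enat t < crash i"
  with step have "Some (x (Suc t) i) = map_option ?\<gamma> (phi i (image_mset (inv ?\<gamma>) ?P))"
    by simp
  \<comment> \<open>The value \<open>None\<close> is impossible, since the equation equates the
    result with a \<open>Some\<close>.\<close>
  then obtain y where y: "phi i (image_mset (inv ?\<gamma>) ?P) = Some y" "x (Suc t) i = ?\<gamma> y"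
    by (cases "phi i (image_mset (inv ?\<gamma>) ?P)") simp_all
  have ne: "image_mset (inv ?\<gamma>) ?P \<noteq> {#}"
    using \<open>0 < n\<close> by (simp add: configuration_def mset_set_empty_iff lessThan_empty_iff)
  obtain d where d: "0 \<le> d" "d \<le> \<alpha>" "y \<in> scaled_CH d (image_mset (inv ?\<gamma>) ?P)"
    using target_in_scaled_CH[OF y(1) ne scale[OF i]] by blast
  have "surj ?\<gamma>" using coord[OF i] by (simp add: surj_local_to_global)
  then have "image_mset ?\<gamma> (image_mset (inv ?\<gamma>) ?P) = ?P"
    by (simp add: image_mset.compositionality o_def surj_f_inv_f)
  then have "x (Suc t) i \<in> scaled_CH d ?P"
    using scaled_CH_local_to_global[OF d(3) ne, of "u i" "A i" "x t i"] y(2) by simp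
  then show "\<exists>d y. 0 \<le> d \<and> d \<le> \<alpha> \<and> y \<in> convex hull (x t ` {..<n}) \<and>
      x (Suc t) i = d *\<^sub>R y + (1 - d) *\<^sub>R centroid n (x t)"
    using d by (auto simp: scaled_CH_def CH_configuration center_of_gravity_configuration)
qed

section \<open>Counting the vertices of the limit by crashed robots\<close>

theorem theorem8:
  fixes \<Phi> :: "target set" and f :: nat
  assumes "\<Phi> \<noteq> {}"
    and "\<And>\<phi>. \<phi> \<in> \<Phi> \<Longrightarrow> target_function \<phi>"
    and "0 \<le> scale_set \<Phi>" and "scale_set \<Phi> < 1"
    and "2 \<le> f"
  shows "compatible_FC_CP \<Phi> f"
  unfolding compatible_FC_CP_def
proof (intro allI impI, elim conjE)
  fix n phi u A act crash x
  assume n: "f + 1 \<le> n" and phi: "\<forall>i<n. phi i \<in> \<Phi>"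
    and coord: "\<forall>i<n. u i > 0 \<and> rotation_matrix (A i)"
    and fair: "fair_schedule n act"
    and faulty: "card {i. i < n \<and> crash i \<noteq> \<infinity>} \<le> f"
    and exec: "execution n phi u A act crash x"
  obtain \<alpha> where \<alpha>: "scale_set \<Phi> = ereal \<alpha>" "\<alpha> < 1"
    using assms(3,4) by (cases "scale_set \<Phi>") auto
  have "scale_fun (phi i) \<le> ereal \<alpha>" if "i < n" for i
    unfolding \<alpha>(1)[symmetric] scale_set_def using phi that by (intro SUP_upper) auto
  then interpret contracting_moves n x "\<lambda>t i. i \<in> act t \<and> enat t < crash i" \<alpha>
    using exec n \<alpha>(2) coord by (intro execution_contracting_moves) auto
  let ?E = "{v. v extreme_point_of limit_hull}"
  let ?F = "{i. i < n \<and> crash i \<noteq> \<infinity>}"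
  have conv: "set_converges_to (\<lambda>t. CH (configuration n (x t))) limit_hull"
    unfolding set_converges_to_def
  proof (intro allI impI)
    fix e :: real assume "e > 0"
    from eventually_hull_at_near[OF this]
    show "\<forall>\<^sub>F t in sequentially. (\<forall>z\<in>CH (configuration n (x t)). \<exists>y\<in>limit_hull. dist z y < e) \<and>
        (\<forall>y\<in>limit_hull. \<exists>z\<in>CH (configuration n (x t)). dist z y < e)"
    proof eventually_elim
      case (elim t)
      have "\<exists>z\<in>hull_at t. dist z y < e" if "y \<in> limit_hull" for y
        using that \<open>e > 0\<close> unfolding limit_hull_def by (intro bexI[of _ y]) auto
      then show ?case using elim by (simp add: CH_configuration hull_at_def)
    qed
  qed
  have "card ?E \<le> f \<and> (\<forall>v\<in>?E. \<exists>i<n. (\<lambda>t. x t i) \<longlonglongrightarrow> v)"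
  \<comment> \<open>A single point has no second vertex to pull the centroid away, so it is treated
    apart; there every robot converges to \<open>p\<close>, and robot 0 is the witness.\<close>
  proof (cases "\<exists>p. limit_hull = {p}")
    case True
    then obtain p where p: "limit_hull = {p}" by blast
    then have E: "?E = {p}" by auto
    have "(\<lambda>t. x t 0) \<longlonglongrightarrow> p"
    proof (rule tendstoI)
      fix e :: real assume "e > 0"
      from eventually_hull_at_near[OF this]
      show "\<forall>\<^sub>F t in sequentially. dist (x t 0) p < e"
        by eventually_elim (use position_in_hull_at[of 0] n_pos p in auto)
    qed
    then show ?thesis using E n_pos assms(5) by auto
  next
    case False
    \<comment> \<open>The rest position is the one at the crash time itself: moves require
      \<open>t\<close> strictly below \<open>crash i\<close>.\<close>
    define q where "q i = x (the_enat (crash i)) i" for i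
    have stop: "\<forall>\<^sub>F t in sequentially. x t i = q i" if i: "i \<in> ?F" for i
    proof -
      obtain c where c: "crash i = enat c" using i by auto
      have "x t i = q i" if "c \<le> t" for t
        using that by (induction t rule: dec_induct) (use i c idle in \<open>auto simp: q_def\<close>)
      then show ?thesis unfolding eventually_sequentially by blast
    qed
    have live: "\<exists>\<^sub>\<infinity>t. i \<in> act t \<and> enat t < crash i" if "i < n" "i \<notin> ?F" for i
      using fair that by (auto simp: fair_schedule_def)
    have occ: "\<exists>i\<in>?F. q i = v" if "v \<in> ?E" for v
      using False that live stop by (intro extreme_point_occupied) auto
    \<comment> \<open>Distinct vertices are occupied by distinct faulty robots, which bounds their
      number by \<open>f\<close>.\<close>
    then have "?E \<subseteq> q ` ?F" by blast
    then have "card ?E \<le> card ?F" by (rule surj_card_le[rotated]) simp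
    moreover have "\<exists>i<n. (\<lambda>t. x t i) \<longlonglongrightarrow> v" if "v \<in> ?E" for v
      using occ[OF that] stop tendsto_eventually by fastforce
    ultimately show ?thesis using faulty by auto
  qed
  moreover have "?E \<noteq> {}"
    using limit_hull_nonempty limit_hull_eq_hull_extreme_points by force
  then have "1 \<le> card ?E" using finite_extreme_points by (simp add: Suc_le_eq card_gt_0_iff)
  ultimately show "\<exists>h C. h \<le> f \<and> convex_ngon h C \<and>
      set_converges_to (\<lambda>t. CH (configuration n (x t))) C \<and>
      (\<forall>v. v extreme_point_of C \<longrightarrow> (\<exists>i<n. (\<lambda>t. x t i) \<longlonglongrightarrow> v))"
    using conv polytope_limit_hull
    by (intro exI[of _ "card ?E"] exI[of _ limit_hull]) (auto simp: convex_ngon_def)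
qed

end
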